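(* Let $n\ge1$, let $N=\{x\in\mathbb{R}^n:-1<x_n<x_{n-1}<\dots<x_1<1\}$ and $\Theta=\{\theta\in\mathbb{R}^n:0<\theta_1<\theta_2<\dots<\theta_n<\pi\}$. For $x\in N$ and $\theta\in\Theta$ let $$H(x,\theta)=\det\left(h(x_i,\theta_j)\right)_{i,j=1}^n,\qquad h(x,\theta)=\frac1\pi\,\frac{1-x^2}{1-2x\cos\theta+x^2}\quad(|x|<1,\ 0<\theta<\pi),$$ $$\tilde H(x,\theta)=\left(\int_\Theta H(x,\theta')\,d\theta'\right)^{-1}H(x,\theta).$$ Then for any $\theta\in\Theta$, $$\lim_{\substack{x\in N\\ x\to0}}\tilde H(x,\theta)=\frac1M\prod_{1\le i<j\le n}|e^{i\theta_i}-e^{i\theta_j}|\,|e^{i\theta_i}-e^{-i\theta_j}|,$$ where $M$ is the corresponding normalisation constant, i.e. the integral over $\theta\in\Theta$ of the product on the right-hand side.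
   Context: The function $h(x,\cdot)$ is the density (in the angle $\theta$) of the first hitting point $e^{i\theta}$ of the unit circle for two-dimensional Brownian motion in the half unit disk $\{|z|<1,\operatorname{Im}z>0\}$ started at $x\in(-1,1)$, with normal reflection on the real axis and absorption on $|z|=1$. The limit $x\to0$ means $x\to(0,\dots,0)$ in $\mathbb{R}^n$. *)

theory Defs
  imports "HOL-Analysis.Analysis"
begin

text \<open>
  \<open>\<real>\<^sup>n\<close> is rendered as \<open>real ^ 'n\<close>, where the index type \<open>'n\<close> is an arbitrary finite linearly
  ordered type; it stands for \<open>{1 < 2 < \<dots> < n}\<close> with \<open>n = CARD('n) \<ge> 1\<close>.
\<close>

definition h :: "real \<Rightarrow> real \<Rightarrow> real" where
  "h x \<theta> = (1 / pi) * ((1 - x\<^sup>2) / (1 - 2 * x * cos \<theta> + x\<^sup>2))"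

definition start_chamber :: "(real ^ 'n::{finite,linorder}) set" where
  "start_chamber = {x. (\<forall>i. -1 < x $ i \<and> x $ i < 1) \<and> (\<forall>i j. i < j \<longrightarrow> x $ j < x $ i)}"

definition angle_chamber :: "(real ^ 'n::{finite,linorder}) set" where
  "angle_chamber = {\<theta>. (\<forall>i. 0 < \<theta> $ i \<and> \<theta> $ i < pi) \<and> (\<forall>i j. i < j \<longrightarrow> \<theta> $ i < \<theta> $ j)}"

definition H :: "real ^ 'n::{finite,linorder} \<Rightarrow> real ^ 'n::{finite,linorder} \<Rightarrow> real" where
  "H x \<theta> = det (\<chi> i j. h (x $ i) (\<theta> $ j))"

definition H_tilde :: "real ^ 'n::{finite,linorder} \<Rightarrow> real ^ 'n::{finite,linorder} \<Rightarrow> real" where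
  "H_tilde x \<theta> = inverse (LINT \<theta>':angle_chamber|lborel. H x \<theta>') * H x \<theta>"

definition limit_weight :: "real ^ 'n::{finite,linorder} \<Rightarrow> real" where
  "limit_weight \<theta> =
     (\<Prod>(i, j) \<in> {(i, j). i < j}.
        norm (cis (\<theta> $ i) - cis (\<theta> $ j)) * norm (cis (\<theta> $ i) - cis (- (\<theta> $ j))))"

end

theory Submission
  imports Defs
begin

text \<open>
  With \<open>c = cos \<theta>\<^sub>j\<close> the kernel is \<open>(1 - x\<^sub>i\<^sup>2) / pi\<close> times \<open>1 / ((1 + x\<^sub>i\<^sup>2) - 2 x\<^sub>i c)\<close>, the reciprocal of an
  affine function of \<open>c\<close> with coefficients depending on \<open>x\<^sub>i\<close> alone. So \<open>H x \<theta>\<close> is, up to the row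
  factors, a Cauchy determinant in homogeneous form, and \<open>det_cauchy\<close> evaluates it for every \<open>x\<close>,
  not just asymptotically (\<open>H_factorization\<close>):
  \<open>H x \<theta> = D x * limit_weight \<theta> / denominators x \<theta>\<close>,
  where \<open>D x > 0\<close> does not depend on \<open>\<theta>\<close> and \<open>denominators x \<theta>\<close> is the product of all
  \<open>1 - 2 x\<^sub>i cos \<theta>\<^sub>j + x\<^sub>i\<^sup>2\<close>. The weight appears because
  \<open>\<bar>e\<^sup>i\<^sup>s - e\<^sup>i\<^sup>t\<bar> \<bar>e\<^sup>i\<^sup>s - e\<^sup>-\<^sup>i\<^sup>t\<bar> = 2 \<bar>cos s - cos t\<bar>\<close>, so that \<open>limit_weight\<close> is, on the angle chamber,
  the Vandermonde product of the numbers \<open>2 cos \<theta>\<^sub>j\<close>.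

  Normalisation cancels \<open>D x\<close>, which carries all of the degeneration of \<open>H x \<theta>\<close> as \<open>x\<close> tends to \<open>0\<close>.
  What remains is \<open>limit_weight \<theta> / denominators x \<theta>\<close> divided by its integral over the chamber. Here
  \<open>denominators x \<theta>\<close> tends to \<open>1\<close> and is bounded below uniformly in \<open>\<theta>\<close> for small \<open>x\<close>, so dominated
  convergence gives the limit of the integral, and the limit is positive because the chamber is
  open and the weight is positive on it.
\<close>

section \<open>The Cauchy determinant\<close>

text \<open>
  The transpose arises from the identity by adding to row \<open>k\<close> a combination of the other rows.
  In a suitable order of the indices the matrix is triangular, but \<open>k\<close> is arbitrary here.
\<close>

lemma det_unit_column:
  fixes c :: "'n::finite \<Rightarrow> 'a::field"
  shows "det (\<chi> i j. if i = j then 1 else if j = k then c i else 0) = 1"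
proof -
  let ?I = "mat 1 :: 'a^'n^'n"
  let ?v = "\<Sum>m\<in>UNIV - {k}. c m *s row m ?I"
  let ?L = "\<chi> i j. if i = j then 1 else if j = k then c i else 0"
  have v: "?v $ j = (if j = k then 0 else c j)" for j
    by (auto simp: row_def mat_def if_distrib if_distribR sum.delta' cong: if_cong)
  have "transpose ?L = (\<chi> i. if i = k then row k ?I + ?v else row i ?I)"
    unfolding vec_eq_iff by (auto simp: v simp del: sum_component)
      (auto simp: transpose_def row_def mat_def)
  also have "det \<dots> = det ?I"
    by (intro det_row_span vec.span_sum vec.span_scale vec.span_base) auto
  finally show ?thesis
    by simp
qed

text \<open>
  All rows but the \<open>k\<close>-th are changed at once: the operation is multiplication from the left by a
  matrix as in \<open>det_unit_column\<close>, which avoids an induction over the rows.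
\<close>

lemma det_clear_rows:
  fixes A :: "'a::field^'n^'n::finite"
  shows "det (\<chi> i j. if i = k then A $ i $ j else A $ i $ j - c i * A $ k $ j) = det A"
    (is "det ?B = _")
proof -
  let ?L = "\<chi> i j. if i = j then 1 else if j = k then c i else 0"
  have "(?L ** ?B) $ i $ j = A $ i $ j" for i j
  proof (cases "i = k")
    case True
    have "(?L ** ?B) $ i $ j = (\<Sum>m\<in>UNIV. if m = k then A $ m $ j else 0)"
      unfolding matrix_matrix_mult_def vec_lambda_beta by (intro sum.cong) (auto simp: True)
    then show ?thesis by (simp add: True)
  next
    case False
    have "(?L ** ?B) $ i $ j =
        (\<Sum>m\<in>UNIV. (if m = i then A $ i $ j - c i * A $ k $ j else 0)
                  + (if m = k then c i * A $ k $ j else 0))"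
      unfolding matrix_matrix_mult_def using False by (auto intro!: sum.cong)
    then show ?thesis by (simp add: sum.distrib)
  qed
  then have "?L ** ?B = A"
    unfolding vec_eq_iff by blast
  then have "det A = det ?L * det ?B"
    by (simp only: flip: det_mul)
  then show ?thesis
    by (simp only: det_unit_column mult_1_left)
qed

text \<open>
  Expansion by the Schur complement of a nonzero pivot. The dimension is part of the type and
  cannot drop, so the pivot stays behind as an isolated diagonal entry.
\<close>

lemma det_pivot:
  fixes A :: "'a::field^'n^'n::finite"
  assumes "A $ k $ k \<noteq> 0"
  shows "det A = det (\<chi> i j. if i = k \<and> j = k then A $ k $ k else if i = k \<or> j = k then 0
                       else A $ i $ j - A $ i $ k * A $ k $ j / A $ k $ k)"
    (is "_ = det ?C")
proof -
  \<comment> \<open>Clear column \<open>k\<close> by row operations, then row \<open>k\<close> by the same operations on the transpose.\<close>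
  let ?B = "\<chi> i j. if i = k then A $ i $ j else A $ i $ j - (A $ i $ k / A $ k $ k) * A $ k $ j"
  let ?T = "transpose ?B"
  have "transpose ?C =
      (\<chi> i j. if i = k then ?T $ i $ j else ?T $ i $ j - (A $ k $ i / A $ k $ k) * ?T $ k $ j)"
    using assms by (auto simp: vec_eq_iff transpose_def)
  then have "det (transpose ?C) = det ?T"
    by (simp only: det_clear_rows)
  then have "det ?C = det ?B"
    by (simp only: det_transpose)
  then show ?thesis
    by (simp only: det_clear_rows)
qed

lemma det_scale_rows_columns:
  fixes A :: "'a::comm_ring_1^'n^'n::finite"
  shows "det (\<chi> i j. r i * s j * A $ i $ j) = (\<Prod>i\<in>UNIV. r i) * (\<Prod>j\<in>UNIV. s j) * det A"
proof -
  have "det (\<chi> i j. r i * s j * A $ i $ j) = det (\<chi> i. r i *s (\<chi> j. s j * A $ i $ j))"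
    by (rule arg_cong[where f = det]) (simp add: vec_eq_iff mult.assoc)
  also have "\<dots> = (\<Prod>i\<in>UNIV. r i) * det (\<chi> i. \<chi> j. s j * A $ i $ j)"
    by (rule det_rows_mul)
  also have "det (\<chi> i. \<chi> j. s j * A $ i $ j) = det (transpose (\<chi> i j. s j * A $ i $ j))"
    by (rule det_transpose[symmetric])
  also have "transpose (\<chi> i j. s j * A $ i $ j) = (\<chi> j. s j *s (transpose A $ j))"
    by (simp add: vec_eq_iff transpose_def)
  also have "det \<dots> = (\<Prod>j\<in>UNIV. s j) * det (\<chi> j. transpose A $ j)"
    by (rule det_rows_mul)
  finally show ?thesis
    by simp
qed

text \<open>
  A symmetric factor takes the same value on a pair and on its sorted version, so a product over
  ordered pairs can be built up by inserting elements in any order.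
\<close>

lemma prod_ordered_pairs_insert:
  fixes k :: "'n::linorder" and f :: "'n \<Rightarrow> 'n \<Rightarrow> 'a::comm_monoid_mult"
  assumes "finite S" "k \<notin> S" and sym: "\<And>i j. f i j = f j i"
  shows "(\<Prod>(i, j) \<in> {(i, j). i \<in> insert k S \<and> j \<in> insert k S \<and> i < j}. f i j) =
         (\<Prod>i\<in>S. f i k) * (\<Prod>(i, j) \<in> {(i, j). i \<in> S \<and> j \<in> S \<and> i < j}. f i j)"
proof -
  let ?P = "{(i, j). i \<in> S \<and> j \<in> S \<and> i < j}"
  let ?g = "\<lambda>i. (min i k, max i k)"
  have fin: "finite ?P"
    by (rule finite_subset[of _ "S \<times> S"]) (use assms in auto)
  have inj: "inj_on ?g S"
    using assms(2) by (auto simp: inj_on_def min_def max_def split: if_splits)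
  have split: "{(i, j). i \<in> insert k S \<and> j \<in> insert k S \<and> i < j} = ?g ` S \<union> ?P"
  proof (intro equalityI subsetI)
    fix p assume "p \<in> {(i, j). i \<in> insert k S \<and> j \<in> insert k S \<and> i < j}"
    then obtain i j where p: "p = (i, j)" "i \<in> insert k S" "j \<in> insert k S" "i < j"
      by auto
    consider "i = k" "j \<in> S" | "j = k" "i \<in> S" | "i \<in> S" "j \<in> S"
      using p by auto
    then show "p \<in> ?g ` S \<union> ?P"
    proof cases
      case 1
      then have "p = ?g j" using p by (auto simp: min_def max_def)
      then show ?thesis using 1 by blast
    next
      case 2
      then have "p = ?g i" using p by (auto simp: min_def max_def)
      then show ?thesis using 2 by blast
    qed (use p in auto)
  next
    fix p assume "p \<in> ?g ` S \<union> ?P"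
    then consider i where "i \<in> S" "p = ?g i" | "p \<in> ?P"
      by blast
    then show "p \<in> {(i, j). i \<in> insert k S \<and> j \<in> insert k S \<and> i < j}"
    proof cases
      case 1
      with assms(2) have "i < k \<or> k < i"
        by (metis neqE)
      with 1 show ?thesis
        by (auto simp: min_def max_def)
    qed auto
  qed
  have "?g ` S \<inter> ?P = {}"
    using assms(2) by (auto simp: min_def max_def split: if_splits)
  then have "(\<Prod>(i, j) \<in> ?g ` S \<union> ?P. f i j) = (\<Prod>(i, j) \<in> ?g ` S. f i j) * (\<Prod>(i, j) \<in> ?P. f i j)"
    by (intro prod.union_disjoint) (use assms fin in auto)
  also have "(\<Prod>(i, j) \<in> ?g ` S. f i j) = (\<Prod>i\<in>S. f i k)"
    unfolding prod.reindex[OF inj] comp_def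
    by (intro prod.cong) (auto simp: min_def max_def sym)
  finally show ?thesis
    unfolding split .
qed

text \<open>
  The Cauchy determinant by induction on its size. The minor with index set \<open>S\<close> is padded by the
  identity, so that minors of all sizes live in one matrix type. The step rests on the fact that
  the Schur complement of a diagonal entry of a Cauchy matrix is the smaller Cauchy matrix with
  rows and columns rescaled. Each factor of the Vandermonde-like product is invariant under exchanging \<open>i\<close>
  and \<open>j\<close>, since both of its parentheses change sign.
\<close>

lemma det_cauchy_block:
  fixes a b c :: "'n::{finite,linorder} \<Rightarrow> 'a::field"
  assumes nz: "\<And>i j. a i - b i * c j \<noteq> 0"
  shows "det (\<chi> i j. if i \<in> S \<and> j \<in> S then 1 / (a i - b i * c j) else if i = j then 1 else 0) =
         (\<Prod>i\<in>S. \<Prod>j\<in>S. 1 / (a i - b i * c j)) *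
         (\<Prod>(i, j) \<in> {(i, j). i \<in> S \<and> j \<in> S \<and> i < j}. (a i * b j - a j * b i) * (c j - c i))"
proof -
  define K where "K i j = 1 / (a i - b i * c j)" for i j
  define B where "B S = (\<chi> i j. if i \<in> S \<and> j \<in> S then K i j else if i = j then 1 else 0)" for S
  define f where "f i j = (a i * b j - a j * b i) * (c j - c i)" for i j
  have sym: "f i j = f j i" for i j
    by (simp add: f_def algebra_simps)
  have schur: "K i j - K i k * K k j / K k k =
      ((a i * b k - a k * b i) * K i k) * ((c k - c j) * K k j) * K i j" for i j k
    unfolding K_def using nz[of i j] nz[of i k] nz[of k k] nz[of k j]
    by (simp add: divide_simps) (simp add: algebra_simps)
  have "det (B S) = (\<Prod>i\<in>S. \<Prod>j\<in>S. K i j) * (\<Prod>(i, j) \<in> {(i, j). i \<in> S \<and> j \<in> S \<and> i < j}. f i j)"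
    using finite[of S]
  proof (induction S rule: finite_induct)
    case empty
    have "B {} = mat 1"
      by (simp add: B_def mat_def)
    then show ?case by simp
  next
    case (insert k S)
    define r where "r i = (if i = k then K k k else if i \<in> S then (a i * b k - a k * b i) * K i k else 1)" for i
    define s where "s j = (if j \<in> S then (c k - c j) * K k j else 1)" for j
    have Kk: "K k k \<noteq> 0"
      using nz by (simp add: K_def)
    let ?B = "B (insert k S)"
    have B: "?B $ k $ k = K k k" "?B $ i $ k = (if i \<in> insert k S then K i k else 0)"
      "?B $ k $ j = (if j \<in> insert k S then K k j else 0)" for i j
      by (auto simp: B_def)
    have schur_B: "(\<chi> i j. if i = k \<and> j = k then ?B $ k $ k else if i = k \<or> j = k then 0
              else ?B $ i $ j - ?B $ i $ k * ?B $ k $ j / ?B $ k $ k) =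
        (\<chi> i j. r i * s j * B S $ i $ j)"
    proof -
      have "(if i = k \<and> j = k then ?B $ k $ k else if i = k \<or> j = k then 0
              else ?B $ i $ j - ?B $ i $ k * ?B $ k $ j / ?B $ k $ k) = r i * s j * B S $ i $ j" for i j
      proof (cases "i \<in> S \<and> j \<in> S")
        case True
        then have "i \<noteq> k" "j \<noteq> k"
          using insert.hyps by auto
        with True show ?thesis
          unfolding B by (simp add: B_def r_def s_def schur)
      next
        case False
        then show ?thesis
          unfolding B using insert.hyps by (auto simp: B_def r_def s_def)
      qed
      then show ?thesis
        by simp
    qed
    have "?B $ k $ k \<noteq> 0"
      using Kk by (simp only: B(1) not_False_eq_True)
    then have "det ?B = det (\<chi> i j. r i * s j * B S $ i $ j)"
      by (rule trans[OF det_pivot arg_cong[where f = det, OF schur_B]])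
    also have "\<dots> = (\<Prod>i\<in>UNIV. r i) * (\<Prod>j\<in>UNIV. s j) * det (B S)"
      by (rule det_scale_rows_columns)
    also have "(\<Prod>i\<in>UNIV. r i) = (\<Prod>i\<in>insert k S. r i)"
      by (rule prod.mono_neutral_right) (auto simp: r_def)
    also have "\<dots> = K k k * (\<Prod>i\<in>S. (a i * b k - a k * b i) * K i k)"
      using insert.hyps by (subst prod.insert) (auto simp: r_def intro!: prod.cong)
    also have "(\<Prod>j\<in>UNIV. s j) = (\<Prod>j\<in>S. s j)"
      by (rule prod.mono_neutral_right) (auto simp: s_def)
    also have "\<dots> = (\<Prod>j\<in>S. (c k - c j) * K k j)"
      by (auto simp: s_def)
    finally have "det (B (insert k S)) =
        K k k * (\<Prod>i\<in>S. K i k) * (\<Prod>j\<in>S. K k j) * (\<Prod>i\<in>S. f i k) * det (B S)"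
      by (simp add: prod.distrib f_def mult_ac)
    also have "\<dots> = (\<Prod>i\<in>insert k S. \<Prod>j\<in>insert k S. K i j) * ((\<Prod>i\<in>S. f i k) *
        (\<Prod>(i, j) \<in> {(i, j). i \<in> S \<and> j \<in> S \<and> i < j}. f i j))"
      using insert.hyps by (simp add: insert.IH prod.distrib mult_ac)
    finally show ?case
      by (simp only: prod_ordered_pairs_insert[OF insert.hyps sym])
  qed
  then show ?thesis
    by (simp only: B_def K_def f_def)
qed

text \<open>
  Homogeneous form of Cauchy's formula: \<open>a i / b i\<close> plays the part of the usual row parameter, and
  \<open>b i = 0\<close> is permitted. This matters because a coordinate of the starting point may vanish.
\<close>

theorem det_cauchy:
  fixes a b c :: "'n::{finite,linorder} \<Rightarrow> 'a::field"
  assumes "\<And>i j. a i - b i * c j \<noteq> 0"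
  shows "det (\<chi> i j. 1 / (a i - b i * c j)) =
         (\<Prod>i\<in>UNIV. \<Prod>j\<in>UNIV. 1 / (a i - b i * c j)) *
         (\<Prod>(i, j) \<in> {(i, j). i < j}. (a i * b j - a j * b i) * (c j - c i))"
  using det_cauchy_block[OF assms, of UNIV] by simp

section \<open>Factorisation of the kernel determinant\<close>

definition denominators :: "real ^ 'n \<Rightarrow> real ^ 'n \<Rightarrow> real" where
  "denominators x \<theta> = (\<Prod>i\<in>UNIV. \<Prod>j\<in>UNIV. 1 - 2 * x $ i * cos (\<theta> $ j) + (x $ i)\<^sup>2)"

text \<open>
  The product of the two differences is \<open>e\<^sup>i\<^sup>s\<close> times the real number \<open>2 (cos s - cos t)\<close>.
\<close>

lemma norm_cis_diff_product:
  "norm (cis s - cis t) * norm (cis s - cis (- t)) = 2 * \<bar>cos s - cos t\<bar>"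
proof -
  have "(cis s - cis t) * (cis s - cis (- t)) = cis s * of_real (2 * (cos s - cos t))"
    using sin_cos_squared_add[of s] sin_cos_squared_add[of t]
    by (simp add: complex_eq_iff algebra_simps power2_eq_square)
  then have "norm ((cis s - cis t) * (cis s - cis (- t))) = norm (cis s * of_real (2 * (cos s - cos t)))"
    by simp
  then show ?thesis
    by (simp only: norm_mult norm_cis norm_of_real abs_mult abs_numeral mult_1_left)
qed

lemma limit_weight_eq_cos:
  fixes \<theta> :: "real ^ 'n::{finite,linorder}"
  assumes "\<theta> \<in> angle_chamber"
  shows "limit_weight \<theta> = (\<Prod>(i, j) \<in> {(i, j). i < j}. 2 * (cos (\<theta> $ i) - cos (\<theta> $ j)))"
  unfolding limit_weight_def
proof (rule prod.cong, safe)
  fix i j :: 'n assume "i < j"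
  then have "cos (\<theta> $ j) < cos (\<theta> $ i)"
    using assms by (intro cos_monotone_0_pi) (auto simp: angle_chamber_def less_imp_le)
  then show "norm (cis (\<theta> $ i) - cis (\<theta> $ j)) * norm (cis (\<theta> $ i) - cis (- (\<theta> $ j))) =
      2 * (cos (\<theta> $ i) - cos (\<theta> $ j))"
    by (simp add: norm_cis_diff_product)
qed

lemma limit_weight_pos:
  fixes \<theta> :: "real ^ 'n::{finite,linorder}"
  assumes "\<theta> \<in> angle_chamber"
  shows "0 < limit_weight \<theta>"
  unfolding limit_weight_eq_cos[OF assms]
proof (rule prod_pos, safe)
  fix i j :: 'n assume "i < j"
  then have "cos (\<theta> $ j) < cos (\<theta> $ i)"
    using assms by (intro cos_monotone_0_pi) (auto simp: angle_chamber_def less_imp_le)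
  then show "0 < 2 * (cos (\<theta> $ i) - cos (\<theta> $ j))"
    by simp
qed

text \<open>
  The right-hand side is \<open>\<bar>x - e\<^sup>i\<^sup>t\<bar>\<^sup>2\<close>, and \<open>1 - \<bar>x\<bar>\<close> is the distance of \<open>x\<close> from the unit circle. That the
  bound is uniform in \<open>t\<close> serves both for nonvanishing denominators and for domination.
\<close>

lemma denominator_ge:
  fixes x t :: real
  assumes "\<bar>x\<bar> \<le> 1"
  shows "(1 - \<bar>x\<bar>)\<^sup>2 \<le> 1 - 2 * x * cos t + x\<^sup>2"
proof -
  have "x * cos t \<le> \<bar>x * cos t\<bar>"
    by (rule abs_ge_self)
  also have "\<dots> \<le> \<bar>x\<bar> * 1"
    unfolding abs_mult by (rule mult_left_mono) auto
  finally show ?thesis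
    by (simp add: power2_eq_square algebra_simps)
qed

text \<open>
  Cauchy's formula with \<open>a i = 1 + x\<^sub>i\<^sup>2\<close>, \<open>b i = 2 x\<^sub>i\<close> and \<open>c j = cos \<theta>\<^sub>j\<close>, for which
  \<open>a i * b j - a j * b i = - 2 (x\<^sub>i - x\<^sub>j) (1 - x\<^sub>i x\<^sub>j)\<close>. The factor \<open>2\<close> joins the difference of
  cosines and the sign is absorbed there too, since cosine decreases on \<open>[0, pi]\<close>.
\<close>

lemma H_factorization:
  fixes x \<theta> :: "real ^ 'n::{finite,linorder}"
  assumes x: "x \<in> start_chamber" and \<theta>: "\<theta> \<in> angle_chamber"
  shows "H x \<theta> =
    (\<Prod>i\<in>UNIV. (1 - (x $ i)\<^sup>2) / pi) *
    (\<Prod>(i, j) \<in> {(i, j). i < j}. (x $ i - x $ j) * (1 - x $ i * x $ j)) *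
    (limit_weight \<theta> / denominators x \<theta>)"
proof -
  let ?a = "\<lambda>i. 1 + (x $ i)\<^sup>2" and ?b = "\<lambda>i. 2 * x $ i" and ?c = "\<lambda>j. cos (\<theta> $ j)"
  have nz: "?a i - ?b i * ?c j \<noteq> 0" for i j
  proof -
    have "\<bar>x $ i\<bar> < 1"
      using x by (auto simp: start_chamber_def abs_less_iff minus_less_iff)
    then have "0 < (1 - \<bar>x $ i\<bar>)\<^sup>2"
      by simp
    also have "\<dots> \<le> ?a i - ?b i * ?c j"
      using denominator_ge[of "x $ i" "\<theta> $ j"] \<open>\<bar>x $ i\<bar> < 1\<close> by simp
    finally show ?thesis
      by simp
  qed
  have den: "1 - 2 * x $ i * cos (\<theta> $ j) + (x $ i)\<^sup>2 = ?a i - ?b i * ?c j" for i j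
    by simp
  have "H x \<theta> = det (\<chi> i j. ((1 - (x $ i)\<^sup>2) / pi) * 1 * (\<chi> i j. 1 / (?a i - ?b i * ?c j)) $ i $ j)"
    unfolding H_def h_def den by simp
  also have "\<dots> = (\<Prod>i\<in>UNIV. (1 - (x $ i)\<^sup>2) / pi) * det (\<chi> i j. 1 / (?a i - ?b i * ?c j))"
    unfolding det_scale_rows_columns by simp
  also have "det (\<chi> i j. 1 / (?a i - ?b i * ?c j)) =
      (\<Prod>i\<in>UNIV. \<Prod>j\<in>UNIV. 1 / (?a i - ?b i * ?c j)) *
      (\<Prod>(i, j) \<in> {(i, j). i < j}. (?a i * ?b j - ?a j * ?b i) * (?c j - ?c i))"
    by (rule det_cauchy[OF nz])
  also have "(\<Prod>i\<in>UNIV. \<Prod>j\<in>UNIV. 1 / (?a i - ?b i * ?c j)) = 1 / denominators x \<theta>"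
    unfolding denominators_def den by (simp only: prod_dividef prod.neutral_const)
  also have "(\<Prod>(i, j) \<in> {(i, j). i < j}. (?a i * ?b j - ?a j * ?b i) * (?c j - ?c i)) =
     (\<Prod>(i, j) \<in> {(i, j). i < j}.
        ((x $ i - x $ j) * (1 - x $ i * x $ j)) * (2 * (?c i - ?c j)))"
    by (intro prod.cong) (auto simp: algebra_simps power2_eq_square)
  also have "\<dots> = (\<Prod>(i, j) \<in> {(i, j). i < j}. (x $ i - x $ j) * (1 - x $ i * x $ j)) * limit_weight \<theta>"
    unfolding limit_weight_eq_cos[OF \<theta>] by (simp add: case_prod_beta flip: prod.distrib)
  finally show ?thesis
    by simp
qed

text \<open>
  The factor of \<open>H x \<theta>\<close> that does not depend on \<open>\<theta>\<close>; it has to be nonzero in order to cancel.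
\<close>

lemma starting_factor_pos:
  fixes x :: "real ^ 'n::{finite,linorder}"
  assumes "x \<in> start_chamber"
  shows "0 < (\<Prod>i\<in>UNIV. (1 - (x $ i)\<^sup>2) / pi) *
    (\<Prod>(i, j) \<in> {(i, j). i < j}. (x $ i - x $ j) * (1 - x $ i * x $ j))"
proof -
  have lt: "\<bar>x $ i\<bar> < 1" for i
    using assms by (auto simp: start_chamber_def abs_less_iff minus_less_iff)
  have "0 < 1 - x $ i * x $ j" for i j
  proof -
    have "\<bar>x $ i\<bar> * \<bar>x $ j\<bar> < 1 * 1"
      by (intro mult_strict_mono lt) auto
    then show ?thesis
      by (simp add: abs_mult flip: abs_mult)
  qed
  moreover have "0 < 1 - (x $ i)\<^sup>2" for i
    using lt[of i] by (simp add: abs_square_less_1)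
  ultimately show ?thesis
    using assms by (auto simp: start_chamber_def intro!: mult_pos_pos prod_pos)
qed

lemma H_tilde_eq:
  fixes x \<theta> :: "real ^ 'n::{finite,linorder}"
  assumes x: "x \<in> start_chamber" and \<theta>: "\<theta> \<in> angle_chamber"
  shows "H_tilde x \<theta> =
    inverse (LINT \<theta>':angle_chamber|lborel. limit_weight \<theta>' / denominators x \<theta>') *
    (limit_weight \<theta> / denominators x \<theta>)"
proof -
  define D where "D = (\<Prod>i\<in>UNIV. (1 - (x $ i)\<^sup>2) / pi) *
    (\<Prod>(i, j) \<in> {(i, j). i < j}. (x $ i - x $ j) * (1 - x $ i * x $ j))"
  have D: "D \<noteq> 0"
    unfolding D_def by (rule less_imp_neq[OF starting_factor_pos[OF x], symmetric])
  have H: "H x \<theta>' = D * (limit_weight \<theta>' / denominators x \<theta>')" if "\<theta>' \<in> angle_chamber" for \<theta>'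
    unfolding D_def by (rule H_factorization[OF x that])
  have "(LINT \<theta>':angle_chamber|lborel. H x \<theta>') =
      (LINT \<theta>':angle_chamber|lborel. D * (limit_weight \<theta>' / denominators x \<theta>'))"
    unfolding set_lebesgue_integral_def
    by (rule Bochner_Integration.integral_cong) (auto simp: H indicator_def)
  also have "\<dots> = D * (LINT \<theta>':angle_chamber|lborel. limit_weight \<theta>' / denominators x \<theta>')"
    by (rule set_integral_mult_right)
  finally show ?thesis
    using D by (simp add: H_tilde_def H[OF \<theta>])
qed

section \<open>Integrals over the angle chamber\<close>

lemma open_angle_chamber: "open (angle_chamber :: (real ^ 'n::{finite,linorder}) set)"
proof -
  have eq: "angle_chamber = (\<Inter>i. {\<theta> :: real ^ 'n::{finite,linorder}. 0 < \<theta> $ i} \<inter> {\<theta>. \<theta> $ i < pi}) \<inter>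
      (\<Inter>(i, j)\<in>{(i, j). i < j}. {\<theta>. \<theta> $ i < \<theta> $ j})"
    by (auto simp: angle_chamber_def)
  show ?thesis
    unfolding eq by (intro open_Int open_INT ballI) (auto intro!: open_Collect_less continuous_intros)
qed

lemma angle_chamber_subset_cbox: "angle_chamber \<subseteq> cbox (0 :: real ^ 'n::{finite,linorder}) (\<chi> i. pi)"
  by (auto simp: angle_chamber_def mem_box_cart less_imp_le)

lemma continuous_on_limit_weight: "continuous_on UNIV (limit_weight :: real ^ 'n::{finite,linorder} \<Rightarrow> real)"
  unfolding limit_weight_def[abs_def] case_prod_beta by (intro continuous_intros)

lemma set_integrable_limit_weight:
  "set_integrable lborel (angle_chamber :: (real ^ 'n::{finite,linorder}) set) limit_weight"
proof (rule set_integrable_subset[OF _ _ angle_chamber_subset_cbox])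
  show "set_integrable lborel (cbox (0 :: real ^ 'n::{finite,linorder}) (\<chi> i. pi)) limit_weight"
    unfolding set_integrable_def
    by (intro borel_integrable_compact compact_cbox continuous_on_subset[OF continuous_on_limit_weight]) auto
qed (simp add: open_angle_chamber)

text \<open>
  If the integral vanished, the positive integrand would force the chamber, which is open and
  nonempty, to be a null set.
\<close>

lemma integral_limit_weight_pos:
  fixes \<theta> :: "real ^ 'n::{finite,linorder}"
  assumes "\<theta> \<in> angle_chamber"
  shows "0 < (LINT \<theta>':(angle_chamber :: (real ^ 'n::{finite,linorder}) set)|lborel. limit_weight \<theta>')"
proof -
  let ?C = "angle_chamber :: (real ^ 'n::{finite,linorder}) set"
  let ?f = "\<lambda>\<theta>'. indicator ?C \<theta>' *\<^sub>R limit_weight \<theta>'"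
  have nonneg: "0 \<le> ?f \<theta>'" for \<theta>'
    by (auto simp: indicator_def less_imp_le limit_weight_pos)
  have "\<not> (AE \<theta>' in lborel. ?f \<theta>' = 0)"
  proof
    assume "AE \<theta>' in lborel. ?f \<theta>' = 0"
    then have "AE \<theta>' in lborel. \<theta>' \<notin> ?C"
      by eventually_elim (auto simp: indicator_def dest: limit_weight_pos)
    then have "?C \<in> null_sets lborel"
      by (subst (asm) AE_iff_null_sets[symmetric]) (auto simp: open_angle_chamber)
    then have "negligible ?C"
      by (simp add: negligible_iff_null_sets null_sets_completionI)
    then show False
      using open_not_negligible[OF open_angle_chamber] assms by blast
  qed
  then have "integral\<^sup>L lborel ?f \<noteq> 0"
    using set_integrable_limit_weight[where 'n = 'n] nonneg
    by (subst integral_nonneg_eq_0_iff_AE) (auto simp: set_integrable_def)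
  moreover have "0 \<le> integral\<^sup>L lborel ?f"
    by (intro Bochner_Integration.integral_nonneg nonneg)
  ultimately show ?thesis
    by (simp add: set_lebesgue_integral_def)
qed

lemma tendsto_denominators:
  assumes "(X \<longlongrightarrow> 0) F"
  shows "((\<lambda>n. denominators (X n) \<theta>) \<longlongrightarrow> 1) F"
proof -
  have "((\<lambda>n. denominators (X n) \<theta>) \<longlongrightarrow> denominators 0 \<theta>) F"
    unfolding denominators_def by (intro tendsto_intros assms)
  then show ?thesis
    by (simp add: denominators_def)
qed

lemma denominators_ge:
  fixes x \<theta> :: "real ^ 'n"
  assumes "norm x \<le> 1 / 2"
  shows "(1 / 4) ^ (CARD('n) * CARD('n)) \<le> denominators x \<theta>"
proof -
  have ge: "1 / 4 \<le> 1 - 2 * x $ i * cos (\<theta> $ j) + (x $ i)\<^sup>2" for i j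
  proof -
    have "\<bar>x $ i\<bar> \<le> 1 / 2"
      using component_le_norm_cart[of x i] assms by linarith
    then have "(1 / 2)\<^sup>2 \<le> (1 - \<bar>x $ i\<bar>)\<^sup>2"
      by (intro power_mono) auto
    with denominator_ge[of "x $ i" "\<theta> $ j"] \<open>\<bar>x $ i\<bar> \<le> 1 / 2\<close> show ?thesis
      by (simp add: power2_eq_square)
  qed
  have "(\<Prod>i\<in>(UNIV :: 'n set). \<Prod>j\<in>(UNIV :: 'n set). 1 / 4) \<le> denominators x \<theta>"
    unfolding denominators_def by (intro prod_mono conjI prod_nonneg ge) auto
  then show ?thesis
    by (simp add: power_mult)
qed

text \<open>
  Dominated convergence along sequences. A fixed multiple of the weight itself is the dominating
  function, once the sequence has entered the ball where \<open>denominators_ge\<close> applies; a shift by \<open>m\<close>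
  discards the terms before that.
\<close>

lemma tendsto_integral_weight_over_denominators:
  fixes S :: "(real ^ 'n::{finite,linorder}) set"
  shows "((\<lambda>x. LINT \<theta>:(angle_chamber :: (real ^ 'n::{finite,linorder}) set)|lborel. limit_weight \<theta> / denominators x \<theta>)
    \<longlongrightarrow> (LINT \<theta>:(angle_chamber :: (real ^ 'n::{finite,linorder}) set)|lborel. limit_weight \<theta>)) (at 0 within S)"
  unfolding tendsto_at_iff_sequentially comp_def
proof (intro allI impI)
  let ?C = "angle_chamber :: (real ^ 'n::{finite,linorder}) set"
  let ?K = "4 ^ (CARD('n::{finite,linorder}) * CARD('n::{finite,linorder})) :: real"
  fix X :: "nat \<Rightarrow> real ^ 'n::{finite,linorder}"
  assume X: "\<forall>i. X i \<in> S - {0}" "X \<longlonglongrightarrow> 0"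
  have "\<forall>\<^sub>F n in sequentially. norm (X n) < 1 / 2"
    using tendstoD[OF X(2), of "1 / 2"] by simp
  then obtain m where m: "norm (X (n + m)) \<le> 1 / 2" for n
    unfolding eventually_sequentially by (meson le_add2 less_imp_le)
  have cont: "continuous_on UNIV (denominators x)" for x :: "real ^ 'n::{finite,linorder}"
    unfolding denominators_def[abs_def] by (intro continuous_intros)
  have [measurable]: "limit_weight \<in> borel_measurable (lborel :: (real ^ 'n::{finite,linorder}) measure)"
    "denominators x \<in> borel_measurable lborel" "?C \<in> sets lborel" for x :: "real ^ 'n::{finite,linorder}"
    using borel_measurable_continuous_onI[OF continuous_on_limit_weight]
      borel_measurable_continuous_onI[OF cont] by (auto simp: open_angle_chamber)
  have int: "integrable lborel (\<lambda>\<theta>. indicator ?C \<theta> *\<^sub>R limit_weight \<theta>)"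
    using set_integrable_limit_weight by (simp add: set_integrable_def)
  show "(\<lambda>n. LINT \<theta>:?C|lborel. limit_weight \<theta> / denominators (X n) \<theta>) \<longlonglongrightarrow> (LINT \<theta>:?C|lborel. limit_weight \<theta>)"
    unfolding set_lebesgue_integral_def
  proof (rule LIMSEQ_offset[of _ m],
      rule integral_dominated_convergence[where w = "\<lambda>\<theta>. ?K * (indicator ?C \<theta> *\<^sub>R limit_weight \<theta>)"])
    show "integrable lborel (\<lambda>\<theta>. ?K * (indicator ?C \<theta> *\<^sub>R limit_weight \<theta>))"
      using int by simp
    show "AE \<theta> in lborel. (\<lambda>n. indicator ?C \<theta> *\<^sub>R (limit_weight \<theta> / denominators (X (n + m)) \<theta>))
        \<longlonglongrightarrow> indicator ?C \<theta> *\<^sub>R limit_weight \<theta>"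
    proof (rule AE_I2)
      fix \<theta> :: "real ^ 'n::{finite,linorder}"
      have "(\<lambda>n. denominators (X (n + m)) \<theta>) \<longlonglongrightarrow> 1"
        by (intro tendsto_denominators LIMSEQ_ignore_initial_segment X(2))
      then have "(\<lambda>n. indicator ?C \<theta> *\<^sub>R (limit_weight \<theta> / denominators (X (n + m)) \<theta>))
          \<longlonglongrightarrow> indicator ?C \<theta> *\<^sub>R (limit_weight \<theta> / 1)"
        by (intro tendsto_intros) auto
      then show "(\<lambda>n. indicator ?C \<theta> *\<^sub>R (limit_weight \<theta> / denominators (X (n + m)) \<theta>))
          \<longlonglongrightarrow> indicator ?C \<theta> *\<^sub>R limit_weight \<theta>"
        by simp
    qed
    show "AE \<theta> in lborel. norm (indicator ?C \<theta> *\<^sub>R (limit_weight \<theta> / denominators (X (n + m)) \<theta>))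
        \<le> ?K * (indicator ?C \<theta> *\<^sub>R limit_weight \<theta>)" for n
    proof (rule AE_I2)
      fix \<theta> :: "real ^ 'n::{finite,linorder}"
      let ?d = "denominators (X (n + m)) \<theta>"
      have d: "1 / ?K \<le> ?d"
        using denominators_ge[OF m, of n \<theta>] by (simp add: power_divide)
      moreover have "0 < 1 / ?K"
        by simp
      ultimately have "0 < ?d"
        by linarith
      have "1 / ?d \<le> ?K"
        using d \<open>0 < ?d\<close> by (simp add: field_simps)
      then have le: "limit_weight \<theta> * (1 / ?d) \<le> limit_weight \<theta> * ?K" if "\<theta> \<in> ?C"
        by (intro mult_left_mono less_imp_le[OF limit_weight_pos[OF that]])
      show "norm (indicator ?C \<theta> *\<^sub>R (limit_weight \<theta> / ?d)) \<le> ?K * (indicator ?C \<theta> *\<^sub>R limit_weight \<theta>)"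
      proof (cases "\<theta> \<in> ?C")
        case True
        have "norm (limit_weight \<theta> / ?d) = limit_weight \<theta> * (1 / ?d)"
          using limit_weight_pos[OF True] \<open>0 < ?d\<close> by simp
        with le[OF True] True show ?thesis
          by (simp only: indicator_simps scaleR_one mult.commute)
      qed simp
    qed
  qed measurable
qed

theorem proposition4p6:
  fixes \<theta> :: "real ^ 'n::{finite,linorder}" and M :: real
  assumes "\<theta> \<in> angle_chamber"
    and "M = (LINT \<theta>':(angle_chamber :: (real ^ 'n::{finite,linorder}) set)|lborel. limit_weight \<theta>')"
  shows "((\<lambda>x. H_tilde x \<theta>) \<longlongrightarrow> (1 / M) * limit_weight \<theta>) (at 0 within start_chamber)"
proof -
  let ?F = "\<lambda>x. inverse (LINT \<theta>':angle_chamber|lborel. limit_weight \<theta>' / denominators x \<theta>') *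
    (limit_weight \<theta> / denominators x \<theta>)"
  have "M \<noteq> 0"
    using integral_limit_weight_pos[OF assms(1)] assms(2) by simp
  then have "(?F \<longlongrightarrow> inverse M * (limit_weight \<theta> / 1)) (at 0 within start_chamber)"
    unfolding assms(2)
    by (intro tendsto_intros tendsto_integral_weight_over_denominators tendsto_denominators tendsto_ident_at) auto
  then have "(?F \<longlongrightarrow> (1 / M) * limit_weight \<theta>) (at 0 within start_chamber)"
    by (simp add: inverse_eq_divide)
  moreover have "\<forall>\<^sub>F x in at 0 within start_chamber. ?F x = H_tilde x \<theta>"
    using H_tilde_eq[OF _ assms(1)] by (auto simp: eventually_at_filter)
  ultimately show ?thesis
    by (rule Lim_transform_eventually)
qed

end
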